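(* Let $\overline{\mathcal G}=\mathrm{span}\{K,H,P,M\}$ be the extended Galilei subalgebra of the Schrödinger algebra $\mathcal S$. Amongst all the extended Galilei Lie bialgebras with generators $\{K,H,P,M\}$, with cocommutators $\delta(K)=\beta_6K\wedge P+\xi K\wedge M+\nu P\wedge H+\beta_1P\wedge M+\beta_2H\wedge M$, $\delta(H)=\beta_5K\wedge M-(\beta_6+\alpha)P\wedge H+\beta_3P\wedge M+(\beta_4-\xi)H\wedge M$, $\delta(P)=\beta_4P\wedge M+(\beta_6+\alpha)H\wedge M$, $\delta(M)=\alpha P\wedge M$, only those with $\alpha=\nu=\beta_5=\beta_6=0$ are Schrödinger Lie sub-bialgebras. The Schrödinger Lie bialgebras which contain $\overline{\mathcal G}$ as a Lie sub-bialgebra are the coboundary ones given by the following $r$-matrix and cocommutators, depending on six real parameters $\xi,\beta_1,\beta_2,\beta_3,\beta_4,a_3$ fulfilling $$\beta_2(2\beta_4-\xi)=0:$$ $$r=a_3P\wedge M+\beta_1H\wedge M-\beta_2P\wedge H-\beta_3K\wedge M+\tfrac12(\beta_4-\xi)D\wedge M-\tfrac12(\beta_4+\xi)P\wedge K,$$ $\delta(K)=\xi K\wedge M+\beta_1P\wedge M+\beta_2H\wedge M$, $\delta(H)=\beta_3P\wedge M+(\beta_4-\xi)H\wedge M$, $\delta(P)=\beta_4P\wedge M$, $\delta(M)=0$, $\delta(D)=-a_3P\wedge M-2\beta_1H\wedge M+3\beta_2P\wedge H-\beta_3K\wedge M$, $\delta(C)=a_3K\wedge M-\beta_1D\wedge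 M-\beta_2(D\wedge P+K\wedge H)-(\beta_4-\xi)C\wedge M$. The Schouten bracket is $[[r,r]]=-\tfrac14(\beta_4+\xi)^2\,K\wedge M\wedge P$.
   Context: $\mathcal S$ is the real 6-dimensional Lie algebra with basis $\{D,H,P,K,C,M\}$ and brackets $[D,P]=-P$, $[D,K]=K$, $[K,P]=M$, $[D,H]=-2H$, $[D,C]=2C$, $[H,C]=D$, $[K,H]=P$, $[K,C]=0$, $[P,C]=-K$, $[P,H]=0$, $[M,\cdot]=0$. The displayed nine-parameter cocommutators $(\alpha,\xi,\nu,\beta_1,\dots,\beta_6\in\mathbb R)$ define a Lie bialgebra on $\overline{\mathcal G}$ when $\alpha\beta_5=0$, $\beta_6(\beta_6+\alpha)=0$, $\beta_4(\beta_6+\alpha)=0$, $\nu(\xi-\beta_4)=0$, $\alpha(\xi-\beta_4)-\nu\beta_5=0$; these conditions are assumed. A Lie bialgebra $(g,\delta)$ is a Lie algebra $g$ with a linear map $\delta:g\to g\otimes g$ which is a 1-cocycle, $\delta([X,Y])=[\delta(X),1\otimes Y+Y\otimes1]+[1\otimes X+X\otimes 1,\delta(Y)]$, and whose dual $\delta^*:g^*\otimes g^*\to g^*$ is a Lie bracket. It is coboundary with $r$-matrix $r$ (skew-symmetric in $g\otimes g$) if $\delta(X)=[1\otimes X+X\otimes1,r]$ for all $X$. For Lie bialgebras $(h,\delta_h)$, $(g,\delta_g)$ with $h\subset g$ a Lie subalgebra, $h$ is a Lie sub-bialgebra of $g$ if $\delta_g(X)\in h\wedge h$ for all $X\in h$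 (and $\delta_g|_h=\delta_h$); a Lie bialgebra on $\overline{\mathcal G}$ is a Schrödinger Lie sub-bialgebra if this holds for some Lie bialgebra structure on $\mathcal S$. Convention: $X\wedge Y=X\otimes Y-Y\otimes X$, $X\wedge Y\wedge Z$ is the signed sum over all six permutations. Schouten bracket: $[[r,r]]=[r_{12},r_{13}]+[r_{12},r_{23}]+[r_{13},r_{23}]$. *)

theory Defs
  imports "HOL-Analysis.Analysis"
begin

section \<open>Tensors over a real vector space with a chosen basis\<close>

text \<open>
  A finite-dimensional real vector space with a basis indexed by \<open>'n\<close> is \<open>real ^ 'n\<close>; its second
  and third tensor powers are the arrays \<open>real ^ 'n ^ 'n\<close> and \<open>real ^ 'n ^ 'n ^ 'n\<close>, so that
  \<open>T $ i $ j\<close> is the coefficient of \<open>e\<^sub>i \<otimes> e\<^sub>j\<close> in \<open>T\<close>.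
\<close>

definition tensor :: "real ^ 'n \<Rightarrow> real ^ 'n \<Rightarrow> real ^ 'n ^ 'n"  (infixl "\<otimes>" 72)
  where "x \<otimes> y = (\<chi> i j. x $ i * y $ j)"

definition wedge :: "real ^ 'n \<Rightarrow> real ^ 'n \<Rightarrow> real ^ 'n ^ 'n"  (infixl "\<^bold>\<and>" 72)
  where "x \<^bold>\<and> y = x \<otimes> y - y \<otimes> x"

definition tensor3 :: "real ^ 'n \<Rightarrow> real ^ 'n \<Rightarrow> real ^ 'n \<Rightarrow> real ^ 'n ^ 'n ^ 'n"
  where "tensor3 x y z = (\<chi> i j k. x $ i * y $ j * z $ k)"

definition wedge3 :: "real ^ 'n \<Rightarrow> real ^ 'n \<Rightarrow> real ^ 'n \<Rightarrow> real ^ 'n ^ 'n ^ 'n"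
  where "wedge3 x y z =
    tensor3 x y z + tensor3 y z x + tensor3 z x y
    - tensor3 y x z - tensor3 x z y - tensor3 z y x"

definition lin_ext :: "('n \<Rightarrow> 'v::real_vector) \<Rightarrow> real ^ 'n \<Rightarrow> 'v"
  where "lin_ext t x = (\<Sum>i\<in>UNIV. x $ i *\<^sub>R t i)"

text \<open>The map \<open>f \<otimes> f\<close> induced by a linear map \<open>f\<close>.\<close>

definition tensor_map :: "(real ^ 'm \<Rightarrow> real ^ 'n) \<Rightarrow> real ^ 'm ^ 'm \<Rightarrow> real ^ 'n ^ 'n"
  where "tensor_map f T =
    (\<Sum>i\<in>UNIV. \<Sum>j\<in>UNIV. T $ i $ j *\<^sub>R (f (axis i 1) \<otimes> f (axis j 1)))"


section \<open>Lie bialgebras\<close>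

definition lie_algebra :: "('v::real_vector \<Rightarrow> 'v \<Rightarrow> 'v) \<Rightarrow> bool"
  where "lie_algebra br \<longleftrightarrow>
    bilinear br \<and> (\<forall>x. br x x = 0) \<and>
    (\<forall>x y z. br x (br y z) + br y (br z x) + br z (br x y) = 0)"

text \<open>\<open>bracket_left br X T\<close> is \<open>[1 \<otimes> X + X \<otimes> 1, T]\<close> and
  \<open>bracket_right br T Y\<close> is \<open>[T, 1 \<otimes> Y + Y \<otimes> 1]\<close>.\<close>

definition bracket_left ::
    "(real ^ 'n \<Rightarrow> real ^ 'n \<Rightarrow> real ^ 'n) \<Rightarrow> real ^ 'n \<Rightarrow> real ^ 'n ^ 'n \<Rightarrow> real ^ 'n ^ 'n"
  where "bracket_left br X T = (\<Sum>i\<in>UNIV. \<Sum>j\<in>UNIV. T $ i $ j *\<^sub>R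
    (axis i 1 \<otimes> br X (axis j 1) + br X (axis i 1) \<otimes> axis j 1))"

definition bracket_right ::
    "(real ^ 'n \<Rightarrow> real ^ 'n \<Rightarrow> real ^ 'n) \<Rightarrow> real ^ 'n ^ 'n \<Rightarrow> real ^ 'n \<Rightarrow> real ^ 'n ^ 'n"
  where "bracket_right br T Y = (\<Sum>i\<in>UNIV. \<Sum>j\<in>UNIV. T $ i $ j *\<^sub>R
    (axis i 1 \<otimes> br (axis j 1) Y + br (axis i 1) Y \<otimes> axis j 1))"

text \<open>
  The dual space is identified with \<open>real ^ 'n\<close> through the dual basis, a functional \<open>f\<close> being
  \<open>X \<mapsto> f \<bullet> X\<close>. Then \<open>(f \<otimes> g) \<bullet> T\<close> is the pairing of \<open>f \<otimes> g\<close> with a tensor \<open>T\<close>, and the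
  transpose of a linear \<open>\<delta>\<close> is \<open>adjoint \<delta>\<close>, characterised by
  \<open>adjoint \<delta> (f \<otimes> g) \<bullet> X = (f \<otimes> g) \<bullet> \<delta> X\<close>.
\<close>

definition dual_bracket ::
    "(real ^ 'n \<Rightarrow> real ^ 'n ^ 'n) \<Rightarrow> real ^ 'n \<Rightarrow> real ^ 'n \<Rightarrow> real ^ 'n"
  where "dual_bracket \<delta> f g = adjoint \<delta> (f \<otimes> g)"

definition lie_bialgebra ::
    "(real ^ 'n \<Rightarrow> real ^ 'n \<Rightarrow> real ^ 'n) \<Rightarrow> (real ^ 'n \<Rightarrow> real ^ 'n ^ 'n) \<Rightarrow> bool"
  where "lie_bialgebra br \<delta> \<longleftrightarrow>
    lie_algebra br \<and> linear \<delta> \<and>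
    (\<forall>X Y. \<delta> (br X Y) = bracket_right br (\<delta> X) Y + bracket_left br X (\<delta> Y)) \<and>
    lie_algebra (dual_bracket \<delta>)"

definition coboundary_with ::
    "(real ^ 'n \<Rightarrow> real ^ 'n \<Rightarrow> real ^ 'n) \<Rightarrow> (real ^ 'n \<Rightarrow> real ^ 'n ^ 'n) \<Rightarrow>
      real ^ 'n ^ 'n \<Rightarrow> bool"
  where "coboundary_with br \<delta> r \<longleftrightarrow>
    transpose r = - r \<and> (\<forall>X. \<delta> X = bracket_left br X r)"

text \<open>
  The subalgebra is a Lie algebra \<open>h\<close> with its own basis together with an injective
  homomorphism \<open>\<iota>\<close> into \<open>g\<close>, the inclusion.
\<close>

definition lie_sub_bialgebra ::
    "(real ^ 'm \<Rightarrow> real ^ 'n) \<Rightarrow>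
      (real ^ 'm \<Rightarrow> real ^ 'm \<Rightarrow> real ^ 'm) \<Rightarrow> (real ^ 'm \<Rightarrow> real ^ 'm ^ 'm) \<Rightarrow>
      (real ^ 'n \<Rightarrow> real ^ 'n \<Rightarrow> real ^ 'n) \<Rightarrow> (real ^ 'n \<Rightarrow> real ^ 'n ^ 'n) \<Rightarrow> bool"
  where "lie_sub_bialgebra \<iota> brh \<delta>h brg \<delta>g \<longleftrightarrow>
    lie_bialgebra brh \<delta>h \<and> lie_bialgebra brg \<delta>g \<and>
    linear \<iota> \<and> inj \<iota> \<and> (\<forall>X Y. \<iota> (brh X Y) = brg (\<iota> X) (\<iota> Y)) \<and>
    (\<forall>X. \<delta>g (\<iota> X) \<in> span {\<iota> Y \<^bold>\<and> \<iota> Z |Y Z. True}) \<and>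
    (\<forall>X. \<delta>g (\<iota> X) = tensor_map \<iota> (\<delta>h X))"

text \<open>
  \<open>r\<^sub>1\<^sub>2 = r \<otimes> 1\<close>, \<open>r\<^sub>2\<^sub>3 = 1 \<otimes> r\<close>, and \<open>r\<^sub>1\<^sub>3\<close> has its legs in the outer factors; for
  \<open>r = \<Sum> r\<^sub>i\<^sub>j e\<^sub>i \<otimes> e\<^sub>j\<close> the summands below are \<open>[r\<^sub>1\<^sub>2, r\<^sub>1\<^sub>3]\<close>, \<open>[r\<^sub>1\<^sub>2, r\<^sub>2\<^sub>3]\<close>, \<open>[r\<^sub>1\<^sub>3, r\<^sub>2\<^sub>3]\<close>.
\<close>

definition schouten ::
    "(real ^ 'n \<Rightarrow> real ^ 'n \<Rightarrow> real ^ 'n) \<Rightarrow> real ^ 'n ^ 'n \<Rightarrow> real ^ 'n ^ 'n ^ 'n"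
  where "schouten br r =
    (\<Sum>i\<in>UNIV. \<Sum>j\<in>UNIV. \<Sum>k\<in>UNIV. \<Sum>l\<in>UNIV. (r $ i $ j * r $ k $ l) *\<^sub>R
      (tensor3 (br (axis i 1) (axis k 1)) (axis j 1) (axis l 1)
       + tensor3 (axis i 1) (br (axis j 1) (axis k 1)) (axis l 1)
       + tensor3 (axis i 1) (axis k 1) (br (axis j 1) (axis l 1))))"


section \<open>The Schroedinger algebra and the extended Galilei algebra\<close>

datatype sch = iD | iH | iP | iK | iC | iM

lemma UNIV_sch: "UNIV = {iD, iH, iP, iK, iC, iM}"
  by (auto intro: sch.exhaust)

instance sch :: finite
  by standard (simp add: UNIV_sch)

abbreviation D\<^sub>S :: "real ^ sch" where "D\<^sub>S \<equiv> axis iD 1"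
abbreviation H\<^sub>S :: "real ^ sch" where "H\<^sub>S \<equiv> axis iH 1"
abbreviation P\<^sub>S :: "real ^ sch" where "P\<^sub>S \<equiv> axis iP 1"
abbreviation K\<^sub>S :: "real ^ sch" where "K\<^sub>S \<equiv> axis iK 1"
abbreviation C\<^sub>S :: "real ^ sch" where "C\<^sub>S \<equiv> axis iC 1"
abbreviation M\<^sub>S :: "real ^ sch" where "M\<^sub>S \<equiv> axis iM 1"

text \<open>Each nonzero bracket of two generators is listed once, in one of its two orders;
  the other order comes from antisymmetrising in \<open>sch_br\<close>.\<close>

fun sch_table :: "sch \<Rightarrow> sch \<Rightarrow> real ^ sch" where
  "sch_table iD iP = - P\<^sub>S"
| "sch_table iD iK = K\<^sub>S"
| "sch_table iK iP = M\<^sub>S"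
| "sch_table iD iH = - 2 *\<^sub>R H\<^sub>S"
| "sch_table iD iC = 2 *\<^sub>R C\<^sub>S"
| "sch_table iH iC = D\<^sub>S"
| "sch_table iK iH = P\<^sub>S"
| "sch_table iP iC = - K\<^sub>S"
| "sch_table _ _ = 0"

definition sch_br :: "real ^ sch \<Rightarrow> real ^ sch \<Rightarrow> real ^ sch"
  where "sch_br x y =
    (\<Sum>i\<in>UNIV. \<Sum>j\<in>UNIV. (x $ i * y $ j) *\<^sub>R (sch_table i j - sch_table j i))"

datatype gal = jK | jH | jP | jM

lemma UNIV_gal: "UNIV = {jK, jH, jP, jM}"
  by (auto intro: gal.exhaust)

instance gal :: finite
  by standard (simp add: UNIV_gal)

abbreviation K\<^sub>G :: "real ^ gal" where "K\<^sub>G \<equiv> axis jK 1"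
abbreviation H\<^sub>G :: "real ^ gal" where "H\<^sub>G \<equiv> axis jH 1"
abbreviation P\<^sub>G :: "real ^ gal" where "P\<^sub>G \<equiv> axis jP 1"
abbreviation M\<^sub>G :: "real ^ gal" where "M\<^sub>G \<equiv> axis jM 1"

definition gal_incl :: "real ^ gal \<Rightarrow> real ^ sch"
  where "gal_incl = lin_ext (\<lambda>i. case i of jK \<Rightarrow> K\<^sub>S | jH \<Rightarrow> H\<^sub>S | jP \<Rightarrow> P\<^sub>S | jM \<Rightarrow> M\<^sub>S)"

lemma range_gal_incl: "range gal_incl = span {K\<^sub>S, H\<^sub>S, P\<^sub>S, M\<^sub>S}"
proof
  have "x $ i *\<^sub>R (case i of jK \<Rightarrow> K\<^sub>S | jH \<Rightarrow> H\<^sub>S | jP \<Rightarrow> P\<^sub>S | jM \<Rightarrow> M\<^sub>S)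
      \<in> span {K\<^sub>S, H\<^sub>S, P\<^sub>S, M\<^sub>S}" for x :: "real ^ gal" and i
    by (rule span_scale, rule span_base) (cases i; simp)
  then show "range gal_incl \<subseteq> span {K\<^sub>S, H\<^sub>S, P\<^sub>S, M\<^sub>S}"
    by (auto simp only: gal_incl_def lin_ext_def intro!: span_sum)
  have "linear gal_incl"
    unfolding gal_incl_def lin_ext_def
    by (rule linearI) (simp_all add: scaleR_left_distrib sum.distrib scaleR_sum_right)
  then have "subspace (range gal_incl)"
    by (simp add: linear_subspace_image)
  moreover have "gal_incl K\<^sub>G = K\<^sub>S" "gal_incl H\<^sub>G = H\<^sub>S" "gal_incl P\<^sub>G = P\<^sub>S" "gal_incl M\<^sub>G = M\<^sub>S"
    by (simp_all add: gal_incl_def lin_ext_def UNIV_gal axis_def)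
  then have "{K\<^sub>S, H\<^sub>S, P\<^sub>S, M\<^sub>S} \<subseteq> range gal_incl"
    by (metis empty_subsetI insert_subset rangeI)
  ultimately show "span {K\<^sub>S, H\<^sub>S, P\<^sub>S, M\<^sub>S} \<subseteq> range gal_incl"
    by (simp add: span_minimal)
qed

text \<open>The bracket of the Schroedinger algebra, restricted to the span of \<open>K, H, P, M\<close>.\<close>

definition gal_br :: "real ^ gal \<Rightarrow> real ^ gal \<Rightarrow> real ^ gal"
  where "gal_br x y = inv gal_incl (sch_br (gal_incl x) (gal_incl y))"

definition gal_cocomm ::
    "real \<Rightarrow> real \<Rightarrow> real \<Rightarrow> real \<Rightarrow> real \<Rightarrow> real \<Rightarrow> real \<Rightarrow> real \<Rightarrow> real \<Rightarrow> real ^ gal \<Rightarrow> real ^ gal ^ gal"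
  where "gal_cocomm \<alpha> \<xi> \<nu> \<beta>1 \<beta>2 \<beta>3 \<beta>4 \<beta>5 \<beta>6 = lin_ext (\<lambda>i. case i of
      jK \<Rightarrow> \<beta>6 *\<^sub>R (K\<^sub>G \<^bold>\<and> P\<^sub>G) + \<xi> *\<^sub>R (K\<^sub>G \<^bold>\<and> M\<^sub>G) + \<nu> *\<^sub>R (P\<^sub>G \<^bold>\<and> H\<^sub>G)
            + \<beta>1 *\<^sub>R (P\<^sub>G \<^bold>\<and> M\<^sub>G) + \<beta>2 *\<^sub>R (H\<^sub>G \<^bold>\<and> M\<^sub>G)
    | jH \<Rightarrow> \<beta>5 *\<^sub>R (K\<^sub>G \<^bold>\<and> M\<^sub>G) - (\<beta>6 + \<alpha>) *\<^sub>R (P\<^sub>G \<^bold>\<and> H\<^sub>G)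
            + \<beta>3 *\<^sub>R (P\<^sub>G \<^bold>\<and> M\<^sub>G) + (\<beta>4 - \<xi>) *\<^sub>R (H\<^sub>G \<^bold>\<and> M\<^sub>G)
    | jP \<Rightarrow> \<beta>4 *\<^sub>R (P\<^sub>G \<^bold>\<and> M\<^sub>G) + (\<beta>6 + \<alpha>) *\<^sub>R (H\<^sub>G \<^bold>\<and> M\<^sub>G)
    | jM \<Rightarrow> \<alpha> *\<^sub>R (P\<^sub>G \<^bold>\<and> M\<^sub>G))"

definition schrodinger_lie_sub_bialgebra :: "(real ^ gal \<Rightarrow> real ^ gal ^ gal) \<Rightarrow> bool"
  where "schrodinger_lie_sub_bialgebra \<delta>h \<longleftrightarrow>
    (\<exists>\<delta>. lie_sub_bialgebra gal_incl gal_br \<delta>h sch_br \<delta>)"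

definition contains_galilei_sub_bialgebra :: "(real ^ sch \<Rightarrow> real ^ sch ^ sch) \<Rightarrow> bool"
  where "contains_galilei_sub_bialgebra \<delta> \<longleftrightarrow>
    (\<exists>\<delta>h. lie_sub_bialgebra gal_incl gal_br \<delta>h sch_br \<delta>)"

definition sch_r :: "real \<Rightarrow> real \<Rightarrow> real \<Rightarrow> real \<Rightarrow> real \<Rightarrow> real \<Rightarrow> real ^ sch ^ sch"
  where "sch_r \<xi> \<beta>1 \<beta>2 \<beta>3 \<beta>4 a3 =
    a3 *\<^sub>R (P\<^sub>S \<^bold>\<and> M\<^sub>S) + \<beta>1 *\<^sub>R (H\<^sub>S \<^bold>\<and> M\<^sub>S) - \<beta>2 *\<^sub>R (P\<^sub>S \<^bold>\<and> H\<^sub>S) - \<beta>3 *\<^sub>R (K\<^sub>S \<^bold>\<and> M\<^sub>S)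
    + (1/2 * (\<beta>4 - \<xi>)) *\<^sub>R (D\<^sub>S \<^bold>\<and> M\<^sub>S) - (1/2 * (\<beta>4 + \<xi>)) *\<^sub>R (P\<^sub>S \<^bold>\<and> K\<^sub>S)"

definition sch_cocomm ::
    "real \<Rightarrow> real \<Rightarrow> real \<Rightarrow> real \<Rightarrow> real \<Rightarrow> real \<Rightarrow> real ^ sch \<Rightarrow> real ^ sch ^ sch"
  where "sch_cocomm \<xi> \<beta>1 \<beta>2 \<beta>3 \<beta>4 a3 = lin_ext (\<lambda>i. case i of
      iK \<Rightarrow> \<xi> *\<^sub>R (K\<^sub>S \<^bold>\<and> M\<^sub>S) + \<beta>1 *\<^sub>R (P\<^sub>S \<^bold>\<and> M\<^sub>S) + \<beta>2 *\<^sub>R (H\<^sub>S \<^bold>\<and> M\<^sub>S)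
    | iH \<Rightarrow> \<beta>3 *\<^sub>R (P\<^sub>S \<^bold>\<and> M\<^sub>S) + (\<beta>4 - \<xi>) *\<^sub>R (H\<^sub>S \<^bold>\<and> M\<^sub>S)
    | iP \<Rightarrow> \<beta>4 *\<^sub>R (P\<^sub>S \<^bold>\<and> M\<^sub>S)
    | iM \<Rightarrow> 0
    | iD \<Rightarrow> - a3 *\<^sub>R (P\<^sub>S \<^bold>\<and> M\<^sub>S) - (2 * \<beta>1) *\<^sub>R (H\<^sub>S \<^bold>\<and> M\<^sub>S) + (3 * \<beta>2) *\<^sub>R (P\<^sub>S \<^bold>\<and> H\<^sub>S)
            - \<beta>3 *\<^sub>R (K\<^sub>S \<^bold>\<and> M\<^sub>S)
    | iC \<Rightarrow> a3 *\<^sub>R (K\<^sub>S \<^bold>\<and> M\<^sub>S) - \<beta>1 *\<^sub>R (D\<^sub>S \<^bold>\<and> M\<^sub>S)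
            - \<beta>2 *\<^sub>R (D\<^sub>S \<^bold>\<and> P\<^sub>S + K\<^sub>S \<^bold>\<and> H\<^sub>S) - (\<beta>4 - \<xi>) *\<^sub>R (C\<^sub>S \<^bold>\<and> M\<^sub>S))"

end

theory Submission
  imports Defs
begin

text \<open>
  Written in coordinates, the map \<open>T \<mapsto> [1 \<otimes> X + X \<otimes> 1, T]\<close> is \<open>T \<mapsto> A T + T A\<^sup>t\<close> with \<open>A\<close> the matrix
  of \<open>ad X\<close>, so that it is a representation and every coboundary is a cocycle. A sub-bialgebra
  structure comes for free from the ambient one: the transpose of the inclusion is a surjective
  homomorphism of the dual algebras. Conversely, let \<open>\<delta>\<close> be a bialgebra structure on the
  Schroedinger algebra with \<open>\<delta> h \<subseteq> h \<wedge> h\<close> for the Galilei subalgebra \<open>h\<close>. The cocycle condition is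
  a linear system with a seven-dimensional solution space; the component of the co-Jacobi identity
  for \<open>P\<close> along \<open>H \<wedge> P \<wedge> M\<close> is the square of one of the seven parameters, and the component for
  \<open>D\<close> gives the relation among the other six.
\<close>

section \<open>Lie bialgebras in coordinates\<close>

lemma linear_axis_expansion:
  fixes f :: "real ^ 'n \<Rightarrow> 'v::real_vector"
  assumes "linear f"
  shows "f x = (\<Sum>i\<in>UNIV. x $ i *\<^sub>R f (axis i 1))"
proof -
  have "f x = f (\<Sum>i\<in>UNIV. x $ i *\<^sub>R axis i 1)"
    using basis_expansion[of x] by (simp add: scalar_mult_eq_scaleR)
  also have "\<dots> = (\<Sum>i\<in>UNIV. x $ i *\<^sub>R f (axis i 1))"
    by (simp only: linear_sum[OF assms] linear_scale[OF assms])
  finally show ?thesis .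
qed

lemma linear_eq_axis:
  fixes f :: "real ^ 'n \<Rightarrow> 'v::real_vector"
  assumes "linear f" "linear g" "\<And>i. f (axis i 1) = g (axis i 1)"
  shows "f x = g x"
  unfolding linear_axis_expansion[OF assms(1), of x] linear_axis_expansion[OF assms(2), of x] assms(3) ..

lemma linear_nth_axis:
  fixes f :: "real ^ 'm \<Rightarrow> real ^ 'n"
  assumes "linear f"
  shows "f x $ k = (\<Sum>j\<in>UNIV. x $ j * f (axis j 1) $ k)"
  by (subst linear_axis_expansion[OF assms]) simp

lemma bilinear_nth_axis:
  fixes br :: "real ^ 'm \<Rightarrow> real ^ 'k \<Rightarrow> real ^ 'n"
  assumes "bilinear br"
  shows "br x y $ a = (\<Sum>i\<in>UNIV. \<Sum>j\<in>UNIV. x $ i * y $ j * br (axis i 1) (axis j 1) $ a)"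
proof -
  have "linear (\<lambda>x. br x y)" and lin: "linear (br (axis i 1))" for i
    using assms by (simp_all add: bilinear_def)
  from this(1) have "br x y $ a = (\<Sum>i\<in>UNIV. x $ i * br (axis i 1) y $ a)"
    by (rule linear_nth_axis)
  then show ?thesis
    by (simp add: linear_nth_axis[OF lin, of _ y] sum_distrib_left mult.assoc)
qed

section \<open>The action of a Lie algebra on two-tensors\<close>

lemma sum_axis_mult:
  "(\<Sum>i\<in>UNIV. axis i (1::real) $ a * g i) = g a"
  "(\<Sum>i\<in>UNIV. g i * axis i (1::real) $ a) = g a"
  by (simp_all add: axis_def if_distrib if_distribR cong: if_cong)

text \<open>\<open>1 \<otimes> X\<close> acts on the second leg, hence on the rows of
  \<open>T\<close>, and \<open>X \<otimes> 1\<close> on the first leg, hence on the columns. The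
  coboundary and cocycle equations are later evaluated through this formula.\<close>

lemma bracket_left_nth:
  assumes "linear (br X)"
  shows "bracket_left br X T $ a $ b = br X (T $ a) $ b + br X (column b T) $ a"
proof -
  have "bracket_left br X T $ a $ b =
      (\<Sum>i\<in>UNIV. \<Sum>j\<in>UNIV. axis i 1 $ a * (T $ i $ j * br X (axis j 1) $ b)) +
      (\<Sum>i\<in>UNIV. \<Sum>j\<in>UNIV. (T $ i $ j * br X (axis i 1) $ a) * axis j 1 $ b)"
    by (simp add: bracket_left_def tensor_def sum.distrib algebra_simps)
  also have "\<dots> = (\<Sum>j\<in>UNIV. T $ a $ j * br X (axis j 1) $ b)
      + (\<Sum>i\<in>UNIV. T $ i $ b * br X (axis i 1) $ a)"
    by (simp add: sum_axis_mult flip: sum_distrib_left)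
  also have "\<dots> = br X (T $ a) $ b + br X (column b T) $ a"
    by (simp only: linear_nth_axis[OF assms, of "T $ a"] linear_nth_axis[OF assms, of "\<chi> i. T $ i $ b"]
        column_def vec_lambda_beta)
  finally show ?thesis .
qed

lemma bracket_left_matrix:
  assumes "linear (br X)"
  shows "bracket_left br X T = matrix (br X) ** T + T ** transpose (matrix (br X))"
  by (simp add: vec_eq_iff bracket_left_nth[where br = br, OF assms] linear_nth_axis[OF assms, of "_ $ _"]
      linear_nth_axis[OF assms, of "\<chi> i. _ $ i $ _"] matrix_matrix_mult_def matrix_def transpose_def
      column_def mult.commute)

lemma linear_bracket_left:
  assumes "bilinear br"
  shows "linear (\<lambda>X. bracket_left br X T)"
proof -
  have "linear (br X)" for X
    using assms by (simp add: bilinear_def)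
  note nth = bracket_left_nth[where br = br, OF this]
  show ?thesis
    by (rule linearI)
      (simp_all add: vec_eq_iff nth bilinear_ladd[OF assms] bilinear_lmul[OF assms] algebra_simps)
qed

lemma lie_algebra_skew:
  assumes "lie_algebra br"
  shows "br y x = - br x y"
proof -
  have b: "bilinear br" and z: "\<And>x. br x x = 0"
    using assms by (auto simp: lie_algebra_def)
  have "br (x + y) (x + y) = br x x + br y x + (br x y + br y y)"
    by (simp add: bilinear_ladd[OF b] bilinear_radd[OF b])
  then show ?thesis
    by (simp add: z eq_neg_iff_add_eq_0)
qed

text \<open>Lets the cocycle condition be written with the left action alone: the cocommutator of
  \<open>br X Y\<close> is \<open>X\<close> acting on that of \<open>Y\<close> minus
  \<open>Y\<close> acting on that of \<open>X\<close>.\<close>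

lemma bracket_right_skew:
  assumes "lie_algebra br"
  shows "bracket_right br T Y = - bracket_left br Y T"
proof -
  have "br x Y = - br Y x" for x
    by (rule lie_algebra_skew[OF assms])
  then show ?thesis
    by (simp add: bracket_left_def bracket_right_def vec_eq_iff tensor_def algebra_simps
        flip: sum_negf)
qed

lemma lie_algebra_linear:
  assumes "lie_algebra br"
  shows "linear (br X)" "linear (\<lambda>x. br x X)"
  using assms by (simp_all add: lie_algebra_def bilinear_def)

lemma lie_algebra_jacobi:
  assumes "lie_algebra br"
  shows "br (br X Y) z = br X (br Y z) - br Y (br X z)"
proof -
  have "br X (br Y z) + br Y (br z X) + br z (br X Y) = 0"
    using assms by (simp add: lie_algebra_def)
  then show ?thesis
    using lie_algebra_skew[OF assms, of z X] lie_algebra_skew[OF assms, of z "br X Y"]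
    by (simp add: linear_neg[OF lie_algebra_linear(1)[OF assms]] algebra_simps add_eq_0_iff)
qed

text \<open>The Jacobi identity, read as the statement that the adjoint map is a homomorphism into
  matrices under the commutator.\<close>

lemma lie_algebra_matrix_bracket:
  fixes br :: "real ^ 'n \<Rightarrow> real ^ 'n \<Rightarrow> real ^ 'n"
  assumes "lie_algebra br"
  shows "matrix (br (br X Y)) =
    matrix (br X) ** matrix (br Y) - matrix (br Y) ** matrix (br X)"
proof -
  note l = lie_algebra_linear(1)[OF assms]
  have "matrix (br (br X Y)) = matrix (\<lambda>z. br X (br Y z) - br Y (br X z))"
    by (rule arg_cong[of _ _ matrix]) (simp add: fun_eq_iff lie_algebra_jacobi[OF assms])
  also have "\<dots> = matrix (br X \<circ> br Y) - matrix (br Y \<circ> br X)"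
    by (simp add: matrix_def vec_eq_iff)
  finally show ?thesis
    by (simp add: matrix_compose[OF l l])
qed

lemma matrix_distribs:
  fixes A B :: "real ^ 'n ^ 'm"
  shows "(A + B) ** C' = A ** C' + B ** C'" "(A - B) ** C' = A ** C' - B ** C'" "C ** (A - B) = C ** A - C ** B"
    "transpose (A - B) = transpose A - transpose B"
  by (simp_all add: vec_eq_iff matrix_matrix_mult_def transpose_def sum_subtractf sum.distrib algebra_simps)

text \<open>With A and B the matrices of \<open>br X\<close> and \<open>br Y\<close>, the mixed
  terms A T B^t and B T A^t cancel in the commutator of the two actions, and the rest is the action
  of AB - BA.\<close>

lemma bracket_left_bracket:
  assumes "lie_algebra br"
  shows "bracket_left br (br X Y) T =
    bracket_left br X (bracket_left br Y T) - bracket_left br Y (bracket_left br X T)"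
  by (simp add: bracket_left_matrix lie_algebra_linear[OF assms] lie_algebra_matrix_bracket[OF assms]
      matrix_distribs matrix_transpose_mul matrix_mul_assoc matrix_add_ldistrib
      matrix_distribs)

section \<open>The dual bracket and the co-Jacobi identity\<close>

lemma tensor_inner: "(f \<otimes> g) \<bullet> T = f \<bullet> (T *v g)"
  by (simp add: tensor_def inner_vec_def matrix_vector_mult_def sum_distrib_left mult_ac)

lemma dual_bracket_inner:
  fixes \<delta> :: "real ^ 'n \<Rightarrow> real ^ 'n ^ 'n"
  assumes "linear \<delta>"
  shows "dual_bracket \<delta> f g \<bullet> X = (f \<otimes> g) \<bullet> \<delta> X"
  by (simp add: dual_bracket_def adjoint_clauses[OF assms])

lemma dual_bracket_nth:
  assumes "linear \<delta>"
  shows "dual_bracket \<delta> f g $ k = (f \<otimes> g) \<bullet> \<delta> (axis k 1)"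
  using dual_bracket_inner[OF assms, of f g "axis k 1"]
  by (simp add: inner_axis)

lemma bilinear_dual_bracket:
  assumes "linear \<delta>"
  shows "bilinear (dual_bracket \<delta>)"
  unfolding bilinear_def
  by (intro conjI allI linearI)
    (simp_all add: vec_eq_iff dual_bracket_nth[OF assms] tensor_inner inner_left_distrib
      inner_right_distrib matrix_vector_right_distrib matrix_vector_mult_scaleR)

text \<open>Skewness of the dual bracket, tested on dual basis vectors, says that the matrix
  \<open>\<delta> X\<close> is skew; thus \<open>\<delta>\<close> takes values in the exterior
  square although its type allows every two-tensor.\<close>

lemma dual_lie_algebra_skew:
  assumes "linear \<delta>" "lie_algebra (dual_bracket \<delta>)"
  shows "\<delta> X $ a $ b = - \<delta> X $ b $ a"
proof -
  have "(axis a 1 \<otimes> axis b 1) \<bullet> \<delta> X = - ((axis b 1 \<otimes> axis a 1) \<bullet> \<delta> X)"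
    using lie_algebra_skew[OF assms(2), of "axis a 1" "axis b 1"]
    by (simp flip: dual_bracket_inner[OF assms(1)])
  then show ?thesis
    by (simp add: tensor_inner inner_axis' matrix_vector_mult_basis column_def)
qed

text \<open>The structure constants of the dual bracket are the coefficients
  \<open>\<delta> (axis i 1) $ b $ c\<close>; the sum is coordinate \<open>k\<close> of the Jacobi
  identity for three dual basis vectors.\<close>

lemma dual_lie_algebra_jacobi:
  assumes "linear \<delta>" "lie_algebra (dual_bracket \<delta>)"
  shows "(\<Sum>i\<in>UNIV. \<delta> (axis k 1) $ a $ i * \<delta> (axis i 1) $ b $ c
    + \<delta> (axis k 1) $ b $ i * \<delta> (axis i 1) $ c $ a
    + \<delta> (axis k 1) $ c $ i * \<delta> (axis i 1) $ a $ b) = 0"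
proof -
  have "dual_bracket \<delta> (axis a 1) v $ k = (\<Sum>i\<in>UNIV. \<delta> (axis k 1) $ a $ i * v $ i)" for a v k
    by (simp add: dual_bracket_nth[OF assms(1)] tensor_inner inner_axis' matrix_vector_mult_def)
  moreover have "dual_bracket \<delta> (axis b 1) (axis c 1) $ i = \<delta> (axis i 1) $ b $ c" for b c i
    by (simp add: dual_bracket_nth[OF assms(1)] tensor_inner inner_axis' matrix_vector_mult_basis
        column_def)
  moreover have "(dual_bracket \<delta> (axis a 1) (dual_bracket \<delta> (axis b 1) (axis c 1))
      + dual_bracket \<delta> (axis b 1) (dual_bracket \<delta> (axis c 1) (axis a 1))
      + dual_bracket \<delta> (axis c 1) (dual_bracket \<delta> (axis a 1) (axis b 1))) $ k = 0"
    using assms(2) by (simp add: lie_algebra_def)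
  ultimately show ?thesis
    by (simp add: sum.distrib)
qed

section \<open>Tensor squares of linear maps\<close>

lemma tensor_map_matrix:
  "tensor_map f T = matrix f ** T ** transpose (matrix f)"
proof -
  have "tensor_map f T $ a $ b = (\<Sum>j\<in>UNIV. \<Sum>i\<in>UNIV.
      f (axis i 1) $ a * T $ i $ j * f (axis j 1) $ b)" for a b
    unfolding tensor_map_def by (subst sum.swap) (simp add: tensor_def mult_ac)
  then show ?thesis
    by (simp add: vec_eq_iff matrix_matrix_mult_def matrix_def transpose_def sum_distrib_right)
qed

text \<open>A homomorphism intertwines the two adjoint actions, so its tensor square intertwines the
  actions on two-tensors. This carries the cocycle condition from one algebra to the other.\<close>

lemma tensor_map_bracket_left:
  fixes \<iota> :: "real ^ 'm \<Rightarrow> real ^ 'n"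
  assumes "linear \<iota>" "linear (brh X)" "linear (brg (\<iota> X))" "\<And>Y. \<iota> (brh X Y) = brg (\<iota> X) (\<iota> Y)"
  shows "tensor_map \<iota> (bracket_left brh X T) = bracket_left brg (\<iota> X) (tensor_map \<iota> T)"
proof -
  have "\<iota> \<circ> brh X = brg (\<iota> X) \<circ> \<iota>"
    using assms(4) by auto
  then have 1: "matrix \<iota> ** matrix (brh X) = matrix (brg (\<iota> X)) ** matrix \<iota>"
    using assms by (simp flip: matrix_compose)
  \<comment> \<open>The same intertwining for the second leg, obtained by transposition.\<close>
  then have 2: "transpose (matrix (brh X)) ** transpose (matrix \<iota>) =
      transpose (matrix \<iota>) ** transpose (matrix (brg (\<iota> X)))"
    by (metis matrix_transpose_mul)
  have "tensor_map \<iota> (bracket_left brh X T) =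
      matrix \<iota> ** matrix (brh X) ** T ** transpose (matrix \<iota>) +
      matrix \<iota> ** T ** (transpose (matrix (brh X)) ** transpose (matrix \<iota>))"
    by (simp add: tensor_map_matrix bracket_left_matrix[where br = brh, OF assms(2)] matrix_add_ldistrib
      matrix_distribs(1) matrix_mul_assoc)
  also have "\<dots> = bracket_left brg (\<iota> X) (tensor_map \<iota> T)"
    by (simp add: 1 2 tensor_map_matrix bracket_left_matrix[where br = brg, OF assms(3)] matrix_mul_assoc)
  finally show ?thesis .
qed

lemma linear_tensor_map: "linear (tensor_map f)"
  by (rule linearI)
    (simp_all add: tensor_map_def scaleR_left_distrib sum.distrib scaleR_sum_right)

lemma tensor_map_wedge:
  assumes "linear f"
  shows "tensor_map f (x \<^bold>\<and> y) = f x \<^bold>\<and> f y"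
proof -
  have "tensor_map f (u \<otimes> v) $ a $ b = (f u \<otimes> f v) $ a $ b" for u v a b
    by (simp add: tensor_map_def tensor_def linear_nth_axis[OF assms, of u]
        linear_nth_axis[OF assms, of v] sum_product mult_ac)
  then have "tensor_map f (u \<otimes> v) = f u \<otimes> f v" for u v
    by (simp add: vec_eq_iff)
  then show ?thesis
    by (simp add: wedge_def linear_diff[OF linear_tensor_map])
qed

text \<open>The transpose of a tensor square is the tensor square of the transpose; compatibility of
  cocommutators thereby becomes a statement about dual brackets.\<close>

lemma tensor_map_inner:
  assumes "linear \<iota>"
  shows "(f \<otimes> g) \<bullet> tensor_map \<iota> T = (adjoint \<iota> f \<otimes> adjoint \<iota> g) \<bullet> T"
proof -
  have "(f \<otimes> g) \<bullet> tensor_map \<iota> T = f \<bullet> \<iota> (T *v (transpose (matrix \<iota>) *v g))"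
    by (simp add: tensor_inner tensor_map_matrix fun_cong[OF matrix_vector_mul(2)[OF assms]]
        flip: matrix_vector_mul_assoc)
  also have "transpose (matrix \<iota>) *v g = adjoint \<iota> g"
    by (metis adjoint_matrix assms matrix_vector_mul)
  finally show ?thesis
    by (simp add: tensor_inner adjoint_clauses assms)
qed

lemma inj_linear_adjoint:
  fixes \<iota> :: "real ^ 'm \<Rightarrow> real ^ 'n"
  assumes "linear \<iota>" "inj \<iota>"
  shows surj_adjoint: "surj (adjoint \<iota>)" and inj_tensor_map: "inj (tensor_map \<iota>)"
proof -
  \<comment> \<open>The left inverse \<open>L\<close> serves both claims: its transpose is a right
    inverse of the adjoint, and the map from T to L T L^t undoes
    \<open>tensor_map \<iota>\<close>.\<close>
  obtain L where L: "L ** matrix \<iota> = mat 1"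
    using assms matrix_left_invertible_injective[of "matrix \<iota>"]
    by auto
  then have R: "transpose (matrix \<iota>) ** transpose L = mat 1"
    by (metis matrix_transpose_mul transpose_mat)
  have "adjoint \<iota> (transpose L *v x) = x" for x
    by (metis R adjoint_matrix assms(1) matrix_vector_mul matrix_vector_mul_assoc
        matrix_vector_mul_lid)
  then show "surj (adjoint \<iota>)"
    by (rule surjI)
  have "L ** tensor_map \<iota> T ** transpose L = T" for T
  proof -
    have "L ** tensor_map \<iota> T ** transpose L =
        (L ** matrix \<iota>) ** T ** (transpose (matrix \<iota>) ** transpose L)"
      by (simp add: tensor_map_matrix matrix_mul_assoc)
    then show ?thesis by (simp add: L R)
  qed
  then show "inj (tensor_map \<iota>)"
    by (metis injI)
qed

text \<open>A skew tensor is one half of the sum of its coefficients times the wedges of basis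
  vectors, and \<open>tensor_map \<iota>\<close> sends each such wedge to the wedge of the
  images.\<close>

lemma tensor_map_skew_in_span:
  assumes "\<And>a b. T $ a $ b = - T $ b $ a"
  shows "tensor_map \<iota> T \<in> span {\<iota> Y \<^bold>\<and> \<iota> Z |Y Z. True}"
proof -
  have "tensor_map \<iota> T = (\<Sum>i\<in>UNIV. \<Sum>j\<in>UNIV. T $ j $ i *\<^sub>R (\<iota> (axis j 1) \<otimes> \<iota> (axis i 1)))"
    unfolding tensor_map_def by (rule sum.swap)
  also have "\<dots> = - (\<Sum>i\<in>UNIV. \<Sum>j\<in>UNIV. T $ i $ j *\<^sub>R (\<iota> (axis j 1) \<otimes> \<iota> (axis i 1)))"
    by (subst assms) (simp add: sum_negf)
  finally have "tensor_map \<iota> T + tensor_map \<iota> T =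
      (\<Sum>i\<in>UNIV. \<Sum>j\<in>UNIV. T $ i $ j *\<^sub>R (\<iota> (axis i 1) \<^bold>\<and> \<iota> (axis j 1)))"
    unfolding tensor_map_def wedge_def scaleR_diff_right sum_subtractf by simp
  then have "tensor_map \<iota> T =
      (1/2) *\<^sub>R (\<Sum>i\<in>UNIV. \<Sum>j\<in>UNIV. T $ i $ j *\<^sub>R (\<iota> (axis i 1) \<^bold>\<and> \<iota> (axis j 1)))"
    by (metis scaleR_half_double)
  also have "\<dots> \<in> span {\<iota> Y \<^bold>\<and> \<iota> Z |Y Z. True}"
    by (intro span_scale span_sum span_base) blast
  finally show ?thesis .
qed

section \<open>Transfer of the axioms to a sub-bialgebra\<close>

lemma lie_algebra_embedded:
  assumes "linear \<iota>" "inj \<iota>" "\<And>X Y. \<iota> (brh X Y) = brg (\<iota> X) (\<iota> Y)" "lie_algebra brg"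
  shows "lie_algebra brh"
proof -
  have b: "bilinear brg"
    using assms(4) by (simp add: lie_algebra_def)
  note inj = injD[OF assms(2)]
  note lin = linear_add[OF assms(1)] linear_scale[OF assms(1)] linear_0[OF assms(1)] assms(3)
    bilinear_ladd[OF b] bilinear_radd[OF b] bilinear_lmul[OF b] bilinear_rmul[OF b]
  show ?thesis
    unfolding lie_algebra_def bilinear_def
    using assms(4) by (auto intro!: linearI inj simp: lin lie_algebra_def)
qed

text \<open>Alternation and the Jacobi identity pass to a homomorphic image, every vector of the
  target being of the form \<open>p f\<close>.\<close>

lemma lie_algebra_surj_image:
  assumes "linear p" "surj p" "\<And>f g. p (brg f g) = brh (p f) (p g)" "bilinear brh"
    "lie_algebra brg"
  shows "lie_algebra brh"
proof -
  have "brh (p f) (p f) = 0" for f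
    using assms(5) by (simp add: lie_algebra_def linear_0[OF assms(1)] flip: assms(3))
  moreover have "brh (p f) (brh (p g) (p h)) + brh (p g) (brh (p h) (p f))
      + brh (p h) (brh (p f) (p g)) = 0" for f g h
    using assms(5) by (simp add: lie_algebra_def linear_0[OF assms(1)]
        flip: assms(3) linear_add[OF assms(1)])
  ultimately show ?thesis
    unfolding lie_algebra_def using assms(2,4) by (metis surjD)
qed

text \<open>The bialgebra axioms of the smaller algebra are inherited: its cocycle condition is
  tested after the injective map \<open>tensor_map \<iota>\<close>, its dual bracket is the image of
  the larger one under the surjective map \<open>adjoint \<iota>\<close>, and the span condition
  follows from skewness.\<close>

lemma lie_sub_bialgebraI:
  fixes \<iota> :: "real ^ 'm \<Rightarrow> real ^ 'n"
  assumes "linear \<iota>" "inj \<iota>" and hom: "\<And>X Y. \<iota> (brh X Y) = brg (\<iota> X) (\<iota> Y)"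
    and g: "lie_bialgebra brg \<delta>g" and "linear \<delta>h"
    and \<delta>: "\<And>X. \<delta>g (\<iota> X) = tensor_map \<iota> (\<delta>h X)"
  shows "lie_sub_bialgebra \<iota> brh \<delta>h brg \<delta>g"
proof -
  have lg: "lie_algebra brg" "linear \<delta>g" "lie_algebra (dual_bracket \<delta>g)"
    using g by (auto simp: lie_bialgebra_def)
  have lh: "lie_algebra brh"
    using lie_algebra_embedded assms lg by blast
  have tmb: "tensor_map \<iota> (bracket_left brh X T) = bracket_left brg (\<iota> X) (tensor_map \<iota> T)" for X T
    by (intro tensor_map_bracket_left assms(1) hom lie_algebra_linear(1) lh lg(1))
  have "tensor_map \<iota> (\<delta>h (brh X Y)) =
      tensor_map \<iota> (bracket_left brh X (\<delta>h Y) - bracket_left brh Y (\<delta>h X))" for X Y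
    using g by (simp add: linear_diff[OF linear_tensor_map] tmb hom lie_bialgebra_def
        bracket_right_skew[OF lg(1)] flip: \<delta>)
  then have coc: "\<delta>h (brh X Y) = bracket_left brh X (\<delta>h Y) - bracket_left brh Y (\<delta>h X)" for X Y
    using inj_tensor_map[OF assms(1,2)] by (meson injD)
  have "adjoint \<iota> (dual_bracket \<delta>g f g') = dual_bracket \<delta>h (adjoint \<iota> f) (adjoint \<iota> g')" for f g'
    by (rule vector_eq_rdot[THEN iffD1])
      (simp add: dual_bracket_inner lg assms adjoint_clauses flip: tensor_map_inner)
  then have "lie_algebra (dual_bracket \<delta>h)"
    using lie_algebra_surj_image[of "adjoint \<iota>"] adjoint_linear surj_adjoint
      bilinear_dual_bracket assms lg by blast
  then have lb: "lie_bialgebra brh \<delta>h"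
    using lh coc assms(5) by (simp add: lie_bialgebra_def bracket_right_skew)
  have "\<delta>g (\<iota> X) \<in> span {\<iota> Y \<^bold>\<and> \<iota> Z |Y Z. True}" for X
    unfolding \<delta> using lb
    by (intro tensor_map_skew_in_span dual_lie_algebra_skew) (auto simp: lie_bialgebra_def)
  then show ?thesis
    using lb assms by (simp add: lie_sub_bialgebra_def)
qed

section \<open>Coboundaries and the Schouten bracket\<close>

lemma coboundary_lie_bialgebra:
  assumes "lie_algebra br" "coboundary_with br \<delta> r" "linear \<delta>" "lie_algebra (dual_bracket \<delta>)"
  shows "lie_bialgebra br \<delta>"
  using assms
  by (simp add: lie_bialgebra_def bracket_right_skew coboundary_with_def bracket_left_bracket)

lemma schouten_nth:
  assumes "bilinear br"
  shows "schouten br r $ a $ b $ c =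
    br (column b r) (column c r) $ a + br (r $ a) (column c r) $ b + br (r $ a) (r $ b) $ c"
proof -
  let ?c = "\<lambda>i j a. br (axis i 1) (axis j 1) $ a"
  let ?e = "\<lambda>i a. axis i (1::real) $ a"
  have "schouten br r $ a $ b $ c =
      (\<Sum>i\<in>UNIV. \<Sum>j\<in>UNIV. \<Sum>k\<in>UNIV. \<Sum>l\<in>UNIV. r $ i $ j * r $ k $ l * ?c i k a * ?e j b * ?e l c)
    + (\<Sum>i\<in>UNIV. \<Sum>j\<in>UNIV. \<Sum>k\<in>UNIV. \<Sum>l\<in>UNIV. r $ i $ j * r $ k $ l * ?c j k b * ?e i a * ?e l c)
    + (\<Sum>i\<in>UNIV. \<Sum>j\<in>UNIV. \<Sum>k\<in>UNIV. \<Sum>l\<in>UNIV. r $ i $ j * r $ k $ l * ?c j l c * ?e i a * ?e k b)"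
    by (simp add: schouten_def tensor3_def sum.distrib distrib_left mult_ac)
  \<comment> \<open>In each summand two Kronecker deltas fix the legs outside the bracket, so two of
    the four summations survive.\<close>
  also have "\<dots> = (\<Sum>i\<in>UNIV. \<Sum>k\<in>UNIV. r $ i $ b * r $ k $ c * ?c i k a)
    + (\<Sum>j\<in>UNIV. \<Sum>k\<in>UNIV. r $ a $ j * r $ k $ c * ?c j k b)
    + (\<Sum>j\<in>UNIV. \<Sum>l\<in>UNIV. r $ a $ j * r $ b $ l * ?c j l c)"
    by (simp add: sum_axis_mult flip: sum_distrib_right)
  finally show ?thesis
    by (simp only: bilinear_nth_axis[OF assms, of "\<chi> i. r $ i $ b"]
        bilinear_nth_axis[OF assms, of "r $ a"] column_def vec_lambda_beta)
qed

section \<open>The Schroedinger bialgebras\<close>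

lemma all_sch: "(\<forall>i. Q i) \<longleftrightarrow> Q iD \<and> Q iH \<and> Q iP \<and> Q iK \<and> Q iC \<and> Q iM"
  by (metis sch.exhaust)

lemma all_gal: "(\<forall>i. Q i) \<longleftrightarrow> Q jK \<and> Q jH \<and> Q jP \<and> Q jM"
  by (metis gal.exhaust)

lemma sum_sch: "(\<Sum>i\<in>UNIV. f i) = f iD + f iH + f iP + f iK + f iC + (f iM :: 'a::ab_group_add)"
  by (simp add: UNIV_sch)

lemma sum_gal: "(\<Sum>i\<in>UNIV. f i) = f jK + f jH + f jP + (f jM :: 'a::ab_group_add)"
  by (simp add: UNIV_gal)

lemma axis_nth: "axis i x $ j = (if j = i then x else 0)"
  by (simp add: axis_def)

lemma column_nth: "column b T $ a = T $ a $ b"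
  by (simp add: column_def)

lemma sch_br_nth:
  "sch_br x y $ iD = x $ iH * y $ iC - x $ iC * y $ iH"
  "sch_br x y $ iH = 2 * (x $ iH * y $ iD - x $ iD * y $ iH)"
  "sch_br x y $ iP = x $ iP * y $ iD - x $ iD * y $ iP + x $ iK * y $ iH - x $ iH * y $ iK"
  "sch_br x y $ iK = x $ iD * y $ iK - x $ iK * y $ iD + x $ iC * y $ iP - x $ iP * y $ iC"
  "sch_br x y $ iC = 2 * (x $ iD * y $ iC - x $ iC * y $ iD)"
  "sch_br x y $ iM = x $ iK * y $ iP - x $ iP * y $ iK"
  by (simp_all add: sch_br_def sum_sch axis_def algebra_simps)

lemma vec_eq_sch:
  "x = y \<longleftrightarrow> x $ iD = y $ iD \<and> x $ iH = y $ iH \<and> x $ iP = y $ iP \<and> x $ iK = y $ iK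
    \<and> x $ iC = y $ iC \<and> x $ iM = y $ iM"
  by (simp add: vec_eq_iff all_sch)

lemma lie_algebra_sch: "lie_algebra sch_br"
  unfolding lie_algebra_def bilinear_def
  by (intro conjI allI linearI; simp add: vec_eq_sch sch_br_nth; simp add: algebra_simps)

lemma bilinear_sch_br: "bilinear sch_br"
  using lie_algebra_sch by (simp add: lie_algebra_def)

lemma gal_incl_nth:
  "gal_incl x $ iD = 0" "gal_incl x $ iH = x $ jH" "gal_incl x $ iP = x $ jP"
  "gal_incl x $ iK = x $ jK" "gal_incl x $ iC = 0" "gal_incl x $ iM = x $ jM"
  by (simp_all add: gal_incl_def lin_ext_def sum_gal axis_def)

lemma linear_gal_incl: "linear gal_incl"
  by (rule linearI) (simp_all add: vec_eq_sch gal_incl_nth)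

lemma inj_gal_incl: "inj gal_incl"
  by (rule injI) (simp add: vec_eq_iff all_sch all_gal gal_incl_nth)

lemma gal_incl_gal_br: "gal_incl (gal_br x y) = sch_br (gal_incl x) (gal_incl y)"
proof -
  let ?z = "sch_br (gal_incl x) (gal_incl y)"
  \<comment> \<open>The witness drops the coordinates along D and C. They vanish because the span of
    K, H, P, M is closed under the bracket, so \<open>inv gal_incl\<close> is applied to an element
    of the range.\<close>
  have "?z = gal_incl (\<chi> i. case i of jK \<Rightarrow> ?z $ iK | jH \<Rightarrow> ?z $ iH | jP \<Rightarrow> ?z $ iP | jM \<Rightarrow> ?z $ iM)"
    by (simp add: vec_eq_sch gal_incl_nth sch_br_nth)
  then show ?thesis
    unfolding gal_br_def by (intro f_inv_into_f) (metis rangeI)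
qed

section \<open>Cocommutators on generators\<close>

lemma linear_lin_ext: "linear (lin_ext t)"
  by (rule linearI) (simp_all add: lin_ext_def algebra_simps sum.distrib scaleR_sum_right)

lemma lin_ext_axis: "lin_ext t (axis i 1) = t i"
proof -
  have "axis i 1 $ j *\<^sub>R t j = (if j = i then t j else 0)" for j
    by (simp add: axis_def)
  then show ?thesis by (simp add: lin_ext_def)
qed

lemma sch_cocomm_axis:
  "sch_cocomm \<xi> \<beta>1 \<beta>2 \<beta>3 \<beta>4 a3 K\<^sub>S =
    \<xi> *\<^sub>R (K\<^sub>S \<^bold>\<and> M\<^sub>S) + \<beta>1 *\<^sub>R (P\<^sub>S \<^bold>\<and> M\<^sub>S) + \<beta>2 *\<^sub>R (H\<^sub>S \<^bold>\<and> M\<^sub>S)"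
  "sch_cocomm \<xi> \<beta>1 \<beta>2 \<beta>3 \<beta>4 a3 H\<^sub>S =
    \<beta>3 *\<^sub>R (P\<^sub>S \<^bold>\<and> M\<^sub>S) + (\<beta>4 - \<xi>) *\<^sub>R (H\<^sub>S \<^bold>\<and> M\<^sub>S)"
  "sch_cocomm \<xi> \<beta>1 \<beta>2 \<beta>3 \<beta>4 a3 P\<^sub>S = \<beta>4 *\<^sub>R (P\<^sub>S \<^bold>\<and> M\<^sub>S)"
  "sch_cocomm \<xi> \<beta>1 \<beta>2 \<beta>3 \<beta>4 a3 M\<^sub>S = 0"
  "sch_cocomm \<xi> \<beta>1 \<beta>2 \<beta>3 \<beta>4 a3 D\<^sub>S =
    - a3 *\<^sub>R (P\<^sub>S \<^bold>\<and> M\<^sub>S) - (2 * \<beta>1) *\<^sub>R (H\<^sub>S \<^bold>\<and> M\<^sub>S) + (3 * \<beta>2) *\<^sub>R (P\<^sub>S \<^bold>\<and> H\<^sub>S)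
      - \<beta>3 *\<^sub>R (K\<^sub>S \<^bold>\<and> M\<^sub>S)"
  "sch_cocomm \<xi> \<beta>1 \<beta>2 \<beta>3 \<beta>4 a3 C\<^sub>S =
    a3 *\<^sub>R (K\<^sub>S \<^bold>\<and> M\<^sub>S) - \<beta>1 *\<^sub>R (D\<^sub>S \<^bold>\<and> M\<^sub>S)
      - \<beta>2 *\<^sub>R (D\<^sub>S \<^bold>\<and> P\<^sub>S + K\<^sub>S \<^bold>\<and> H\<^sub>S) - (\<beta>4 - \<xi>) *\<^sub>R (C\<^sub>S \<^bold>\<and> M\<^sub>S)"
  by (simp_all add: sch_cocomm_def lin_ext_axis)

lemma gal_cocomm_axis:
  "gal_cocomm \<alpha> \<xi> \<nu> \<beta>1 \<beta>2 \<beta>3 \<beta>4 \<beta>5 \<beta>6 K\<^sub>G =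
    \<beta>6 *\<^sub>R (K\<^sub>G \<^bold>\<and> P\<^sub>G) + \<xi> *\<^sub>R (K\<^sub>G \<^bold>\<and> M\<^sub>G) + \<nu> *\<^sub>R (P\<^sub>G \<^bold>\<and> H\<^sub>G)
      + \<beta>1 *\<^sub>R (P\<^sub>G \<^bold>\<and> M\<^sub>G) + \<beta>2 *\<^sub>R (H\<^sub>G \<^bold>\<and> M\<^sub>G)"
  "gal_cocomm \<alpha> \<xi> \<nu> \<beta>1 \<beta>2 \<beta>3 \<beta>4 \<beta>5 \<beta>6 H\<^sub>G =
    \<beta>5 *\<^sub>R (K\<^sub>G \<^bold>\<and> M\<^sub>G) - (\<beta>6 + \<alpha>) *\<^sub>R (P\<^sub>G \<^bold>\<and> H\<^sub>G)
      + \<beta>3 *\<^sub>R (P\<^sub>G \<^bold>\<and> M\<^sub>G) + (\<beta>4 - \<xi>) *\<^sub>R (H\<^sub>G \<^bold>\<and> M\<^sub>G)"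
  "gal_cocomm \<alpha> \<xi> \<nu> \<beta>1 \<beta>2 \<beta>3 \<beta>4 \<beta>5 \<beta>6 P\<^sub>G =
    \<beta>4 *\<^sub>R (P\<^sub>G \<^bold>\<and> M\<^sub>G) + (\<beta>6 + \<alpha>) *\<^sub>R (H\<^sub>G \<^bold>\<and> M\<^sub>G)"
  "gal_cocomm \<alpha> \<xi> \<nu> \<beta>1 \<beta>2 \<beta>3 \<beta>4 \<beta>5 \<beta>6 M\<^sub>G = \<alpha> *\<^sub>R (P\<^sub>G \<^bold>\<and> M\<^sub>G)"
  by (simp_all add: gal_cocomm_def lin_ext_axis)

lemma gal_incl_axis:
  "gal_incl K\<^sub>G = K\<^sub>S" "gal_incl H\<^sub>G = H\<^sub>S" "gal_incl P\<^sub>G = P\<^sub>S" "gal_incl M\<^sub>G = M\<^sub>S"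
  by (simp_all add: gal_incl_def lin_ext_axis)

lemma linear_sch_cocomm: "linear (sch_cocomm \<xi> \<beta>1 \<beta>2 \<beta>3 \<beta>4 a3)"
  unfolding sch_cocomm_def by (rule linear_lin_ext)

lemma linear_gal_cocomm: "linear (gal_cocomm \<alpha> \<xi> \<nu> \<beta>1 \<beta>2 \<beta>3 \<beta>4 \<beta>5 \<beta>6)"
  unfolding gal_cocomm_def by (rule linear_lin_ext)

section \<open>The six-parameter coboundary family\<close>

lemma wedge_nth: "(x \<^bold>\<and> y) $ a $ b = x $ a * y $ b - y $ a * x $ b"
  by (simp add: wedge_def tensor_def)

lemma tensor_inner_wedge: "(f \<otimes> g) \<bullet> (x \<^bold>\<and> y) = (f \<bullet> x) * (g \<bullet> y) - (f \<bullet> y) * (g \<bullet> x)"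
proof -
  have "(f \<otimes> g) \<bullet> (u \<otimes> v) = (f \<bullet> u) * (g \<bullet> v)" for u v :: "real ^ 'a"
    by (simp add: tensor_def inner_vec_def sum_product mult_ac)
  then show ?thesis by (simp add: wedge_def inner_diff_right)
qed

lemma coboundary_sch_cocomm:
  "coboundary_with sch_br (sch_cocomm \<xi> \<beta>1 \<beta>2 \<beta>3 \<beta>4 a3) (sch_r \<xi> \<beta>1 \<beta>2 \<beta>3 \<beta>4 a3)"
proof -
  let ?r = "sch_r \<xi> \<beta>1 \<beta>2 \<beta>3 \<beta>4 a3" and ?\<delta> = "sch_cocomm \<xi> \<beta>1 \<beta>2 \<beta>3 \<beta>4 a3"
  have "transpose ?r = - ?r"
    by (simp add: sch_r_def vec_eq_iff transpose_def wedge_nth algebra_simps)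
  \<comment> \<open>Both sides are linear in the argument, so the six generators decide the
    identity.\<close>
  moreover have "?\<delta> (axis i 1) = bracket_left sch_br (axis i 1) ?r" for i
    by (cases i) (simp_all add: sch_cocomm_axis vec_eq_sch
      bracket_left_nth[where br = sch_br, OF lie_algebra_linear(1)[OF lie_algebra_sch]]
      sch_br_nth sch_r_def wedge_nth column_nth axis_nth field_simps)
  then have "?\<delta> X = bracket_left sch_br X ?r" for X
    by (rule linear_eq_axis[OF linear_sch_cocomm linear_bracket_left[OF bilinear_sch_br]])
  ultimately show ?thesis
    by (simp add: coboundary_with_def)
qed

text \<open>\<open>w f g i j\<close> pairs \<open>f \<otimes> g\<close> with the wedge of the basis
  vectors \<open>i\<close> and \<open>j\<close>, so each coordinate of the dual bracket reproduces
  the cocommutator of the corresponding generator.\<close>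

lemma dual_sch_cocomm_nth:
  fixes \<xi> \<beta>1 \<beta>2 \<beta>3 \<beta>4 a3 :: real
  defines "d \<equiv> dual_bracket (sch_cocomm \<xi> \<beta>1 \<beta>2 \<beta>3 \<beta>4 a3)"
    and "w \<equiv> \<lambda>f g i j. f $ i * g $ j - f $ j * g $ i"
  shows
    "d f g $ iK = \<xi> * w f g iK iM + \<beta>1 * w f g iP iM + \<beta>2 * w f g iH iM"
    "d f g $ iH = \<beta>3 * w f g iP iM + (\<beta>4 - \<xi>) * w f g iH iM"
    "d f g $ iP = \<beta>4 * w f g iP iM"
    "d f g $ iM = 0"
    "d f g $ iD = - a3 * w f g iP iM - 2 * \<beta>1 * w f g iH iM + 3 * \<beta>2 * w f g iP iH
      - \<beta>3 * w f g iK iM"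
    "d f g $ iC = a3 * w f g iK iM - \<beta>1 * w f g iD iM - \<beta>2 * (w f g iD iP + w f g iK iH)
      - (\<beta>4 - \<xi>) * w f g iC iM"
  by (simp_all add: d_def w_def dual_bracket_nth[OF linear_sch_cocomm] sch_cocomm_axis
      inner_add_right inner_diff_right tensor_inner_wedge inner_axis)

lemma lie_algebra_dual_sch_cocomm:
  assumes "\<beta>2 * (2 * \<beta>4 - \<xi>) = 0"
  shows "lie_algebra (dual_bracket (sch_cocomm \<xi> \<beta>1 \<beta>2 \<beta>3 \<beta>4 a3))"
proof -
  let ?d = "dual_bracket (sch_cocomm \<xi> \<beta>1 \<beta>2 \<beta>3 \<beta>4 a3)"
  \<comment> \<open>Either case eliminates one parameter and leaves a polynomial identity without
    side condition.\<close>
  have "\<beta>2 = 0 \<or> \<xi> = 2 * \<beta>4"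
    using assms by auto
  then have "?d x (?d y z) + ?d y (?d z x) + ?d z (?d x y) = 0" for x y z
    by (elim disjE; simp add: vec_eq_sch dual_sch_cocomm_nth; simp add: algebra_simps)
  moreover have "?d x x = 0" for x
    by (simp add: vec_eq_sch dual_sch_cocomm_nth)
  ultimately show ?thesis
    using bilinear_dual_bracket[OF linear_sch_cocomm] by (simp add: lie_algebra_def)
qed

lemma schouten_sch_r:
  assumes "\<beta>2 * (2 * \<beta>4 - \<xi>) = 0"
  shows "schouten sch_br (sch_r \<xi> \<beta>1 \<beta>2 \<beta>3 \<beta>4 a3) =
    (- (1/4) * (\<beta>4 + \<xi>)\<^sup>2) *\<^sub>R wedge3 K\<^sub>S M\<^sub>S P\<^sub>S"
proof -
  \<comment> \<open>The component of the Schouten bracket along H, P, M is a multiple of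
    \<open>\<beta>2 * (2 * \<beta>4 - \<xi>)\<close>; splitting the relation removes it in both
    cases.\<close>
  have c: "\<beta>2 = 0 \<or> \<xi> = 2 * \<beta>4"
    using assms by auto
  from schouten_nth[OF bilinear_sch_br] show ?thesis
    using c
    by (elim disjE; simp add: vec_eq_iff all_sch sch_br_nth sch_r_def wedge_nth column_nth axis_nth
        wedge3_def tensor3_def; simp add: field_simps power2_eq_square)
qed

text \<open>After \<open>lie_sub_bialgebraI\<close> the two cocommutators are compared on the four
  Galilei generators. The parameter \<open>a3\<close> is free of the Galilei side, since it occurs
  only in the cocommutators of D and C.\<close>

lemma sub_bialgebra_sch_cocomm:
  assumes "\<beta>2 * (2 * \<beta>4 - \<xi>) = 0"
  shows "lie_sub_bialgebra gal_incl gal_br (gal_cocomm 0 \<xi> 0 \<beta>1 \<beta>2 \<beta>3 \<beta>4 0 0)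
    sch_br (sch_cocomm \<xi> \<beta>1 \<beta>2 \<beta>3 \<beta>4 a3)"
proof (rule lie_sub_bialgebraI)
  show "lie_bialgebra sch_br (sch_cocomm \<xi> \<beta>1 \<beta>2 \<beta>3 \<beta>4 a3)"
    by (rule coboundary_lie_bialgebra[OF lie_algebra_sch coboundary_sch_cocomm
        linear_sch_cocomm lie_algebra_dual_sch_cocomm[OF assms]])
  have lin: "linear (\<lambda>X. sch_cocomm \<xi> \<beta>1 \<beta>2 \<beta>3 \<beta>4 a3 (gal_incl X))"
    "linear (\<lambda>X. tensor_map gal_incl (gal_cocomm 0 \<xi> 0 \<beta>1 \<beta>2 \<beta>3 \<beta>4 0 0 X))"
    using linear_compose[OF linear_gal_incl linear_sch_cocomm]
      linear_compose[OF linear_gal_cocomm linear_tensor_map] by (simp_all add: o_def)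
  have "sch_cocomm \<xi> \<beta>1 \<beta>2 \<beta>3 \<beta>4 a3 (gal_incl (axis i 1)) =
      tensor_map gal_incl (gal_cocomm 0 \<xi> 0 \<beta>1 \<beta>2 \<beta>3 \<beta>4 0 0 (axis i 1))" for i
    by (cases i) (simp_all add: gal_incl_axis gal_cocomm_axis sch_cocomm_axis
      linear_add[OF linear_tensor_map] linear_scale[OF linear_tensor_map]
      linear_0[OF linear_tensor_map] tensor_map_wedge[OF linear_gal_incl])
  then show "sch_cocomm \<xi> \<beta>1 \<beta>2 \<beta>3 \<beta>4 a3 (gal_incl X) =
      tensor_map gal_incl (gal_cocomm 0 \<xi> 0 \<beta>1 \<beta>2 \<beta>3 \<beta>4 0 0 X)" for X
    by (rule linear_eq_axis[OF lin])
qed (simp_all add: linear_gal_incl inj_gal_incl gal_incl_gal_br linear_gal_cocomm)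

section \<open>Classification of the structures that restrict to the Galilei subalgebra\<close>

lemma sch_br_axis:
  "sch_br D\<^sub>S H\<^sub>S = - 2 *\<^sub>R H\<^sub>S" "sch_br D\<^sub>S P\<^sub>S = - P\<^sub>S" "sch_br D\<^sub>S K\<^sub>S = K\<^sub>S" "sch_br D\<^sub>S C\<^sub>S = 2 *\<^sub>R C\<^sub>S"
  "sch_br D\<^sub>S M\<^sub>S = 0" "sch_br H\<^sub>S P\<^sub>S = 0" "sch_br H\<^sub>S K\<^sub>S = - P\<^sub>S" "sch_br H\<^sub>S C\<^sub>S = D\<^sub>S"
  "sch_br P\<^sub>S C\<^sub>S = - K\<^sub>S" "sch_br P\<^sub>S M\<^sub>S = 0" "sch_br K\<^sub>S C\<^sub>S = 0"
  by (simp_all add: vec_eq_sch sch_br_nth axis_nth)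

text \<open>Neither leg of a tensor from the subalgebra points along D or C; this turns invariance
  of the subalgebra into vanishing coefficients for the linear system.\<close>

lemma tensor_map_gal_incl_nth:
  "tensor_map gal_incl T $ iD $ b = 0" "tensor_map gal_incl T $ iC $ b = 0"
  "tensor_map gal_incl T $ a $ iD = 0" "tensor_map gal_incl T $ a $ iC = 0"
  by (simp_all add: tensor_map_def tensor_def gal_incl_nth)

text \<open>The parameters are recovered as coefficients of \<open>\<delta>\<close>: three from K
  and one each from H, P and C. As \<open>\<delta>h\<close> is arbitrary, the classification does
  not presuppose the nine-parameter form.\<close>

lemma sub_bialgebra_eq_sch_cocomm:
  assumes "lie_sub_bialgebra gal_incl gal_br \<delta>h sch_br \<delta>"
  obtains \<xi> \<beta>1 \<beta>2 \<beta>3 \<beta>4 a3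
    where "\<beta>2 * (2 * \<beta>4 - \<xi>) = 0" "\<delta> = sch_cocomm \<xi> \<beta>1 \<beta>2 \<beta>3 \<beta>4 a3"
proof -
  have lb: "lie_bialgebra sch_br \<delta>" and sub: "\<And>X. \<delta> (gal_incl X) = tensor_map gal_incl (\<delta>h X)"
    using assms by (auto simp: lie_sub_bialgebra_def)
  then have lin: "linear \<delta>" and dual: "lie_algebra (dual_bracket \<delta>)"
    by (auto simp: lie_bialgebra_def)
  have "\<delta> (sch_br X Y) = bracket_left sch_br X (\<delta> Y) - bracket_left sch_br Y (\<delta> X)" for X Y
    using lb by (simp add: lie_bialgebra_def bracket_right_skew)
  then have coc: "\<delta> (sch_br X Y) $ a $ b =
      sch_br X (\<delta> Y $ a) $ b + sch_br X (column b (\<delta> Y)) $ a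
      - (sch_br Y (\<delta> X $ a) $ b + sch_br Y (column b (\<delta> X)) $ a)" for X Y a b
    by (simp add: bracket_left_nth[where br = sch_br, OF lie_algebra_linear(1)[OF lie_algebra_sch]])
  have skew: "\<delta> X $ a $ b = - \<delta> X $ b $ a" for X a b
    by (rule dual_lie_algebra_skew[OF lin dual])
  have diag: "\<delta> X $ a $ a = 0" for X a
    using skew[of X a a] by simp
  have "\<delta> (gal_incl X) $ iD $ a = 0" "\<delta> (gal_incl X) $ iC $ a = 0"
    "\<delta> (gal_incl X) $ a $ iD = 0" "\<delta> (gal_incl X) $ a $ iC = 0" for X a
    by (simp_all add: sub tensor_map_gal_incl_nth)
  note gal = this[of H\<^sub>G, unfolded gal_incl_axis] this[of P\<^sub>G, unfolded gal_incl_axis]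
    this[of K\<^sub>G, unfolded gal_incl_axis] this[of M\<^sub>G, unfolded gal_incl_axis]
  \<comment> \<open>The skewness rules are oriented so that indices increase in the order D, H, P,
    K, C, M, which leaves ninety coefficients as unknowns. By \<open>gal\<close>, thirty-six of them
    vanish.\<close>
  note [simp] = sch_br_axis sch_br_nth column_nth axis_nth diag gal
    linear_neg[OF lin] linear_0[OF lin] linear_scale[OF lin]
    skew[of _ iH iD] skew[of _ iP iD] skew[of _ iK iD] skew[of _ iC iD] skew[of _ iM iD]
    skew[of _ iP iH] skew[of _ iK iH] skew[of _ iC iH] skew[of _ iM iH] skew[of _ iK iP]
    skew[of _ iC iP] skew[of _ iM iP] skew[of _ iC iK] skew[of _ iM iK] skew[of _ iM iC]
  \<comment> \<open>The equations are listed so that, given the preceding ones, each determines a further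
    coefficient.\<close>
  note e =
    coc[of D\<^sub>S H\<^sub>S iD iH] coc[of D\<^sub>S H\<^sub>S iD iK] coc[of D\<^sub>S H\<^sub>S iD iM]
    coc[of D\<^sub>S H\<^sub>S iH iC] coc[of D\<^sub>S H\<^sub>S iH iM] coc[of D\<^sub>S H\<^sub>S iP iK]
    coc[of D\<^sub>S H\<^sub>S iK iM] coc[of D\<^sub>S P\<^sub>S iD iM] coc[of D\<^sub>S K\<^sub>S iD iP]
    coc[of D\<^sub>S K\<^sub>S iD iM] coc[of D\<^sub>S K\<^sub>S iH iP] coc[of D\<^sub>S K\<^sub>S iC iM]
    coc[of D\<^sub>S C\<^sub>S iD iH] coc[of D\<^sub>S C\<^sub>S iH iP] coc[of D\<^sub>S C\<^sub>S iH iM]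
    coc[of D\<^sub>S C\<^sub>S iP iK] coc[of D\<^sub>S C\<^sub>S iP iM] coc[of D\<^sub>S M\<^sub>S iH iP]
    coc[of D\<^sub>S M\<^sub>S iH iK] coc[of D\<^sub>S M\<^sub>S iH iM] coc[of D\<^sub>S M\<^sub>S iP iM]
    coc[of D\<^sub>S M\<^sub>S iK iM] coc[of H\<^sub>S P\<^sub>S iH iP] coc[of H\<^sub>S P\<^sub>S iH iM]
    coc[of H\<^sub>S C\<^sub>S iP iK] coc[of P\<^sub>S C\<^sub>S iD iP] coc[of P\<^sub>S C\<^sub>S iP iC]
    coc[of P\<^sub>S C\<^sub>S iC iM] coc[of P\<^sub>S M\<^sub>S iP iM] coc[of K\<^sub>S C\<^sub>S iD iK]
    coc[of K\<^sub>S C\<^sub>S iP iC] coc[of K\<^sub>S C\<^sub>S iC iM] coc[of D\<^sub>S P\<^sub>S iK iM]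
    coc[of H\<^sub>S K\<^sub>S iP iK]
  \<comment> \<open>Thirty-four further coefficients vanish, leaving twenty unknowns.\<close>
  have [simp]:
    "\<delta> D\<^sub>S $ iH $ iC = 0" "\<delta> D\<^sub>S $ iK $ iC = 0" "\<delta> D\<^sub>S $ iC $ iM = 0"
    "\<delta> D\<^sub>S $ iD $ iC = 0" "\<delta> D\<^sub>S $ iD $ iM = 0" "\<delta> H\<^sub>S $ iP $ iK = 0"
    "\<delta> H\<^sub>S $ iK $ iM = 0" "\<delta> D\<^sub>S $ iD $ iK = 0" "\<delta> D\<^sub>S $ iD $ iH = 0"
    "\<delta> D\<^sub>S $ iD $ iP = 0" "\<delta> K\<^sub>S $ iH $ iP = 0" "\<delta> D\<^sub>S $ iP $ iC = 0"
    "\<delta> C\<^sub>S $ iD $ iH = 0" "\<delta> C\<^sub>S $ iH $ iP = 0" "\<delta> C\<^sub>S $ iH $ iM = 0"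
    "\<delta> C\<^sub>S $ iP $ iK = 0" "\<delta> C\<^sub>S $ iP $ iM = 0" "\<delta> M\<^sub>S $ iH $ iP = 0"
    "\<delta> M\<^sub>S $ iH $ iK = 0" "\<delta> M\<^sub>S $ iH $ iM = 0" "\<delta> M\<^sub>S $ iP $ iM = 0"
    "\<delta> M\<^sub>S $ iK $ iM = 0" "\<delta> P\<^sub>S $ iH $ iK = 0" "\<delta> H\<^sub>S $ iH $ iK = 0"
    "\<delta> D\<^sub>S $ iP $ iK = 0" "\<delta> P\<^sub>S $ iH $ iP = 0" "\<delta> C\<^sub>S $ iD $ iC = 0"
    "\<delta> C\<^sub>S $ iK $ iC = 0" "\<delta> M\<^sub>S $ iP $ iK = 0" "\<delta> K\<^sub>S $ iH $ iK = 0"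
    "\<delta> C\<^sub>S $ iH $ iC = 0" "\<delta> C\<^sub>S $ iP $ iC = 0" "\<delta> P\<^sub>S $ iK $ iM = 0"
    "\<delta> P\<^sub>S $ iP $ iK = 0"
    using e[simplified] by simp_all
  note e' =
    coc[of D\<^sub>S H\<^sub>S iP iM] coc[of D\<^sub>S C\<^sub>S iD iM] coc[of D\<^sub>S K\<^sub>S iP iM]
    coc[of D\<^sub>S C\<^sub>S iH iK] coc[of D\<^sub>S K\<^sub>S iH iM] coc[of D\<^sub>S C\<^sub>S iD iP]
    coc[of D\<^sub>S C\<^sub>S iK iM] coc[of P\<^sub>S C\<^sub>S iD iM] coc[of D\<^sub>S P\<^sub>S iH iM]
    coc[of H\<^sub>S K\<^sub>S iH iM] coc[of D\<^sub>S K\<^sub>S iP iK] coc[of H\<^sub>S C\<^sub>S iD iM]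
    coc[of H\<^sub>S K\<^sub>S iP iM]
  \<comment> \<open>Thirteen of the twenty unknowns are expressed through the other seven: the six
    parameters of the family and \<open>\<delta> C\<^sub>S $ iD $ iK\<close>, which linear equations
    alone do not remove.\<close>
  have [simp]:
    "\<delta> D\<^sub>S $ iH $ iP = - 3 * \<delta> K\<^sub>S $ iH $ iM"
    "\<delta> D\<^sub>S $ iH $ iM = - 2 * \<delta> K\<^sub>S $ iP $ iM"
    "\<delta> D\<^sub>S $ iP $ iM = - \<delta> C\<^sub>S $ iK $ iM"
    "\<delta> D\<^sub>S $ iK $ iM = - \<delta> H\<^sub>S $ iP $ iM"
    "\<delta> C\<^sub>S $ iD $ iM = - \<delta> K\<^sub>S $ iP $ iM"
    "\<delta> C\<^sub>S $ iH $ iK = \<delta> K\<^sub>S $ iH $ iM"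
    "\<delta> C\<^sub>S $ iD $ iP = - \<delta> K\<^sub>S $ iH $ iM"
    "\<delta> C\<^sub>S $ iC $ iM = \<delta> K\<^sub>S $ iK $ iM - \<delta> P\<^sub>S $ iP $ iM"
    "\<delta> H\<^sub>S $ iH $ iM = \<delta> P\<^sub>S $ iP $ iM - \<delta> K\<^sub>S $ iK $ iM"
    "\<delta> D\<^sub>S $ iH $ iK = \<delta> C\<^sub>S $ iD $ iK"
    "\<delta> H\<^sub>S $ iH $ iP = \<delta> C\<^sub>S $ iD $ iK"
    "\<delta> P\<^sub>S $ iH $ iM = \<delta> C\<^sub>S $ iD $ iK"
    "\<delta> K\<^sub>S $ iP $ iK = - \<delta> C\<^sub>S $ iD $ iK"
    using e'[simplified] by - (linarith+)
  have jac: "(\<Sum>i\<in>UNIV. \<delta> (axis k 1) $ a $ i * \<delta> (axis i 1) $ b $ c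
    + \<delta> (axis k 1) $ b $ i * \<delta> (axis i 1) $ c $ a
    + \<delta> (axis k 1) $ c $ i * \<delta> (axis i 1) $ a $ b) = 0" for k a b c
    by (rule dual_lie_algebra_jacobi[OF lin dual])
  \<comment> \<open>Write t for this coefficient. It is the coefficient of H wedge M in the
    cocommutator of P and of H wedge P in that of H; their product is the only surviving term, so
    the identity reads t^2 = 0 up to sign.\<close>
  have [simp]: "\<delta> C\<^sub>S $ iD $ iK = 0"
    using jac[of iP iH iP iM] by (simp add: sum_sch)
  \<comment> \<open>The surviving terms of this co-Jacobi component add up to -3 times the left-hand
    side.\<close>
  have "\<delta> K\<^sub>S $ iH $ iM * (2 * \<delta> P\<^sub>S $ iP $ iM - \<delta> K\<^sub>S $ iK $ iM) = 0"
    using jac[of iD iH iP iM] by (auto simp: sum_sch algebra_simps)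
  moreover have "\<delta> = sch_cocomm (\<delta> K\<^sub>S $ iK $ iM) (\<delta> K\<^sub>S $ iP $ iM) (\<delta> K\<^sub>S $ iH $ iM)
      (\<delta> H\<^sub>S $ iP $ iM) (\<delta> P\<^sub>S $ iP $ iM) (\<delta> C\<^sub>S $ iK $ iM)" (is "_ = ?\<delta>")
  proof
    have "\<delta> (axis i 1) = ?\<delta> (axis i 1)" for i
      by (cases i) (simp_all add: sch_cocomm_axis vec_eq_sch wedge_nth)
    then show "\<delta> X = ?\<delta> X" for X
      by (rule linear_eq_axis[OF lin linear_sch_cocomm])
  qed
  ultimately show ?thesis
    by (rule that)
qed

section \<open>Consequences for the Galilei cocommutators and the Schroedinger structures\<close>

theorem proposition4p3:
  shows
   "(\<forall>\<alpha> \<xi> \<nu> \<beta>1 \<beta>2 \<beta>3 \<beta>4 \<beta>5 \<beta>6 :: real.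
       \<alpha> * \<beta>5 = 0 \<and> \<beta>6 * (\<beta>6 + \<alpha>) = 0 \<and> \<beta>4 * (\<beta>6 + \<alpha>) = 0 \<and>
       \<nu> * (\<xi> - \<beta>4) = 0 \<and> \<alpha> * (\<xi> - \<beta>4) - \<nu> * \<beta>5 = 0 \<longrightarrow>
       schrodinger_lie_sub_bialgebra (gal_cocomm \<alpha> \<xi> \<nu> \<beta>1 \<beta>2 \<beta>3 \<beta>4 \<beta>5 \<beta>6) \<longrightarrow>
       \<alpha> = 0 \<and> \<nu> = 0 \<and> \<beta>5 = 0 \<and> \<beta>6 = 0)
  \<and> (\<forall>\<delta>. contains_galilei_sub_bialgebra \<delta> \<longleftrightarrow>
       (\<exists>\<xi> \<beta>1 \<beta>2 \<beta>3 \<beta>4 a3 :: real.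
          \<beta>2 * (2 * \<beta>4 - \<xi>) = 0 \<and>
          coboundary_with sch_br \<delta> (sch_r \<xi> \<beta>1 \<beta>2 \<beta>3 \<beta>4 a3) \<and>
          \<delta> = sch_cocomm \<xi> \<beta>1 \<beta>2 \<beta>3 \<beta>4 a3))
  \<and> (\<forall>\<xi> \<beta>1 \<beta>2 \<beta>3 \<beta>4 a3 :: real. \<beta>2 * (2 * \<beta>4 - \<xi>) = 0 \<longrightarrow>
       coboundary_with sch_br (sch_cocomm \<xi> \<beta>1 \<beta>2 \<beta>3 \<beta>4 a3) (sch_r \<xi> \<beta>1 \<beta>2 \<beta>3 \<beta>4 a3) \<and>
       lie_sub_bialgebra gal_incl
         gal_br (gal_cocomm 0 \<xi> 0 \<beta>1 \<beta>2 \<beta>3 \<beta>4 0 0)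
         sch_br (sch_cocomm \<xi> \<beta>1 \<beta>2 \<beta>3 \<beta>4 a3) \<and>
       schouten sch_br (sch_r \<xi> \<beta>1 \<beta>2 \<beta>3 \<beta>4 a3)
         = (- (1/4) * (\<beta>4 + \<xi>)\<^sup>2) *\<^sub>R wedge3 K\<^sub>S M\<^sub>S P\<^sub>S)"
proof (intro conjI allI impI)
  fix \<alpha> \<xi> \<nu> \<beta>1 \<beta>2 \<beta>3 \<beta>4 \<beta>5 \<beta>6 :: real
  let ?\<delta>h = "gal_cocomm \<alpha> \<xi> \<nu> \<beta>1 \<beta>2 \<beta>3 \<beta>4 \<beta>5 \<beta>6"
  assume "schrodinger_lie_sub_bialgebra ?\<delta>h"
  then obtain \<delta> where s: "lie_sub_bialgebra gal_incl gal_br ?\<delta>h sch_br \<delta>"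
    unfolding schrodinger_lie_sub_bialgebra_def by blast
  obtain \<xi>' b1 b2 b3 b4 a3 where \<delta>: "\<delta> = sch_cocomm \<xi>' b1 b2 b3 b4 a3"
    by (rule sub_bialgebra_eq_sch_cocomm[OF s])
  have eq: "tensor_map gal_incl (?\<delta>h X) $ a $ b = sch_cocomm \<xi>' b1 b2 b3 b4 a3 (gal_incl X) $ a $ b"
    for X a b
    using s by (simp add: lie_sub_bialgebra_def \<delta>)
  note simps = gal_incl_axis gal_cocomm_axis sch_cocomm_axis linear_add[OF linear_tensor_map]
    linear_diff[OF linear_tensor_map] linear_scale[OF linear_tensor_map]
    tensor_map_wedge[OF linear_gal_incl] wedge_nth axis_nth
  \<comment> \<open>Each of the four coefficients chosen here and below isolates one parameter of
    \<open>gal_cocomm\<close> and is absent from \<open>sch_cocomm\<close>, whatever the values of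
    its six parameters.\<close>
  show "\<alpha> = 0"
    using eq[of M\<^sub>G iP iM] by (simp add: simps)
  show "\<nu> = 0"
    using eq[of K\<^sub>G iP iH] by (simp add: simps)
  show "\<beta>5 = 0"
    using eq[of H\<^sub>G iK iM] by (simp add: simps)
  show "\<beta>6 = 0"
    using eq[of K\<^sub>G iK iP] by (simp add: simps)
next
  fix \<delta>
  show "contains_galilei_sub_bialgebra \<delta> \<longleftrightarrow>
       (\<exists>\<xi> \<beta>1 \<beta>2 \<beta>3 \<beta>4 a3 :: real.
          \<beta>2 * (2 * \<beta>4 - \<xi>) = 0 \<and>
          coboundary_with sch_br \<delta> (sch_r \<xi> \<beta>1 \<beta>2 \<beta>3 \<beta>4 a3) \<and>
          \<delta> = sch_cocomm \<xi> \<beta>1 \<beta>2 \<beta>3 \<beta>4 a3)"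
    unfolding contains_galilei_sub_bialgebra_def
  proof safe
    fix \<delta>h
    assume "lie_sub_bialgebra gal_incl gal_br \<delta>h sch_br \<delta>"
    then obtain \<xi> \<beta>1 \<beta>2 \<beta>3 \<beta>4 a3
      where "\<beta>2 * (2 * \<beta>4 - \<xi>) = 0" "\<delta> = sch_cocomm \<xi> \<beta>1 \<beta>2 \<beta>3 \<beta>4 a3"
      by (rule sub_bialgebra_eq_sch_cocomm)
    then show "\<exists>\<xi> \<beta>1 \<beta>2 \<beta>3 \<beta>4 a3. \<beta>2 * (2 * \<beta>4 - \<xi>) = 0 \<and>
        coboundary_with sch_br \<delta> (sch_r \<xi> \<beta>1 \<beta>2 \<beta>3 \<beta>4 a3) \<and>
        \<delta> = sch_cocomm \<xi> \<beta>1 \<beta>2 \<beta>3 \<beta>4 a3"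
      using coboundary_sch_cocomm by fast
  qed (use sub_bialgebra_sch_cocomm in fast)
qed (simp_all add: coboundary_sch_cocomm sub_bialgebra_sch_cocomm schouten_sch_r)

end
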